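(* Let $f\colon \mathbb{R}^n_{>0}\to\mathbb{R}$ be a signomial. If there exists a strict separating vector of $\sigma(f)$, then (i) $f^{-1}(\mathbb{R}_{<0})$ is non-empty and contractible; (ii) the closure of $f^{-1}(\mathbb{R}_{<0})$ in $\mathbb{R}^n_{>0}$ equals $f^{-1}(\mathbb{R}_{\leq 0})$. In particular, $V_{>0}^c(f)$ has at most one negative connected component.
   Context: A signomial is a function $f\colon \mathbb{R}^n_{>0}\to\mathbb{R}$, $f(x)=\sum_{\mu\in\sigma(f)}c_\mu x^\mu$, where the support $\sigma(f)\subseteq\mathbb{R}^n$ is a finite set (real exponents allowed), $c_\mu\in\mathbb{R}\setminus\{0\}$, and $x^\mu=x_1^{\mu_1}\cdots x_n^{\mu_n}$. Put $\sigma_+(f)=\{\mu\in\sigma(f)\mid c_\mu>0\}$ and $\sigma_-(f)=\{\mu\in\sigma(f)\mid c_\mu<0\}$. $V_{>0}^c(f)=\{x\in\mathbb{R}^n_{>0}\mid f(x)\neq 0\}$; a connected component of it is negative if $f<0$ on it. A vector $v\in\mathbb{R}^n$ is a separating vector of $\sigma(f)$ if for some $a\in\mathbb{R}$ one has $v\cdot\beta\geq a$ for all $\beta\in\sigma_-(f)$ and $v\cdot\alpha\leq a$ for all $\alpha\in\sigma_+(f)$. It is strict if, moreover, for some such $a$ there exists $\beta_0\in\sigma_-(f)$ with $v\cdot\beta_0>a$. *)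

theory Defs
  imports "HOL-Analysis.Analysis"
begin

definition pos_orthant :: "(real ^ 'n) set" where
  "pos_orthant = {x. \<forall>i. 0 < x $ i}"

definition monomial :: "real ^ 'n \<Rightarrow> real ^ 'n \<Rightarrow> real" where
  "monomial \<mu> x = (\<Prod>i\<in>UNIV. (x $ i) powr (\<mu> $ i))"

text \<open>
  A signomial is a function on the positive orthant; HOL functions being total, the values of
  \<open>f\<close> elsewhere are unconstrained. \<open>S\<close> is the support of \<open>f\<close>, and \<open>c\<close> gives its coefficients;
  the values of \<open>c\<close> outside \<open>S\<close> are irrelevant. As distinct monomials are linearly
  independent on the positive orthant, \<open>S\<close> and \<open>c\<close> restricted to \<open>S\<close> are determined by \<open>f\<close>.
\<close>

definition signomial ::
    "(real ^ 'n \<Rightarrow> real) \<Rightarrow> (real ^ 'n) set \<Rightarrow> (real ^ 'n \<Rightarrow> real) \<Rightarrow> bool" where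
  "signomial f S c \<longleftrightarrow>
     finite S \<and> (\<forall>\<mu>\<in>S. c \<mu> \<noteq> 0) \<and>
     (\<forall>x\<in>pos_orthant. f x = (\<Sum>\<mu>\<in>S. c \<mu> * monomial \<mu> x))"

definition pos_support :: "(real ^ 'n) set \<Rightarrow> (real ^ 'n \<Rightarrow> real) \<Rightarrow> (real ^ 'n) set" where
  "pos_support S c = {\<mu> \<in> S. c \<mu> > 0}"

definition neg_support :: "(real ^ 'n) set \<Rightarrow> (real ^ 'n \<Rightarrow> real) \<Rightarrow> (real ^ 'n) set" where
  "neg_support S c = {\<mu> \<in> S. c \<mu> < 0}"

definition separates_at ::
    "(real ^ 'n) set \<Rightarrow> (real ^ 'n \<Rightarrow> real) \<Rightarrow> real ^ 'n \<Rightarrow> real \<Rightarrow> bool" where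
  "separates_at S c v a \<longleftrightarrow>
     (\<forall>\<beta>\<in>neg_support S c. v \<bullet> \<beta> \<ge> a) \<and> (\<forall>\<alpha>\<in>pos_support S c. v \<bullet> \<alpha> \<le> a)"

definition separating_vector ::
    "(real ^ 'n) set \<Rightarrow> (real ^ 'n \<Rightarrow> real) \<Rightarrow> real ^ 'n \<Rightarrow> bool" where
  "separating_vector S c v \<longleftrightarrow> (\<exists>a. separates_at S c v a)"

definition strict_separating_vector ::
    "(real ^ 'n) set \<Rightarrow> (real ^ 'n \<Rightarrow> real) \<Rightarrow> real ^ 'n \<Rightarrow> bool" where
  "strict_separating_vector S c v \<longleftrightarrow>
     separating_vector S c v \<and>
     (\<exists>a. separates_at S c v a \<and> (\<exists>\<beta>\<^sub>0\<in>neg_support S c. v \<bullet> \<beta>\<^sub>0 > a))"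

definition nonvanishing_set :: "(real ^ 'n \<Rightarrow> real) \<Rightarrow> (real ^ 'n) set" where
  "nonvanishing_set f = {x \<in> pos_orthant. f x \<noteq> 0}"

definition negative_component :: "(real ^ 'n \<Rightarrow> real) \<Rightarrow> (real ^ 'n) set \<Rightarrow> bool" where
  "negative_component f C \<longleftrightarrow> C \<in> components (nonvanishing_set f) \<and> (\<forall>x\<in>C. f x < 0)"

end

theory Submission
  imports Defs
begin

text \<open>
  Let \<open>v\<close> separate strictly at level \<open>a\<close>, with \<open>\<delta> = v \<bullet> \<beta>\<^sub>0 - a > 0\<close>, and consider the flow
  \<open>x\<^sub>i \<mapsto> x\<^sub>i exp (s v\<^sub>i)\<close>. Along it each term of \<open>exp (- s a) f\<close> is nonincreasing for \<open>s \<ge> 0\<close>, and the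
  term of \<open>\<beta>\<^sub>0\<close> decreases at rate at least \<open>\<delta> B\<close>, where \<open>B\<close> is its absolute value at \<open>x\<close>. Hence the
  flow preserves \<open>{f < 0}\<close>, enters it immediately from \<open>{f \<le> 0}\<close>, and carries every \<open>x\<close> of the
  orthant into it within time \<open>(1 + \<bar>f x\<bar>) / (\<delta> B)\<close>. Flowing for that time is a continuous map from
  the contractible orthant to \<open>{f < 0}\<close> whose restriction to \<open>{f < 0}\<close> is homotopic to the identity.
\<close>

text \<open>In logarithmic coordinates this is translation by \<open>s\<close> times
  \<open>v\<close>, while monomials become exponentials of linear forms; hence on the orthant the
  flow multiplies each monomial by a scalar.\<close>

definition monomial_flow :: "real ^ 'n \<Rightarrow> real \<Rightarrow> real ^ 'n \<Rightarrow> real ^ 'n" where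
  "monomial_flow v s x = (\<chi> i. x $ i * exp (s * v $ i))"

lemma monomial_flow_0 [simp]: "monomial_flow v 0 x = x"
  by (simp add: monomial_flow_def vec_eq_iff)

lemma monomial_flow_in_pos_orthant [simp]:
  "monomial_flow v s x \<in> pos_orthant \<longleftrightarrow> x \<in> pos_orthant"
  by (simp add: monomial_flow_def pos_orthant_def zero_less_mult_iff)

lemma continuous_on_monomial_flow [continuous_intros]:
  assumes "continuous_on A s" "continuous_on A g"
  shows "continuous_on A (\<lambda>x. monomial_flow v (s x) (g x))"
  unfolding monomial_flow_def by (intro continuous_intros assms)

lemma monomial_pos: "x \<in> pos_orthant \<Longrightarrow> 0 < monomial \<mu> x"
  by (simp add: monomial_def pos_orthant_def less_imp_neq [symmetric] prod_pos)

lemma monomial_monomial_flow: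
  assumes "x \<in> pos_orthant"
  shows "monomial \<mu> (monomial_flow v s x) = monomial \<mu> x * exp (s * (v \<bullet> \<mu>))"
proof -
  have "monomial \<mu> (monomial_flow v s x)
      = (\<Prod>i\<in>UNIV. (x $ i) powr (\<mu> $ i) * exp (s * (v $ i * \<mu> $ i)))"
    unfolding monomial_def monomial_flow_def using assms
    by (intro prod.cong)
      (auto simp: pos_orthant_def less_imp_neq [symmetric] powr_def ln_mult algebra_simps exp_add)
  also have "\<dots> = monomial \<mu> x * exp (s * (v \<bullet> \<mu>))"
    by (simp add: monomial_def prod.distrib inner_vec_def sum_distrib_left exp_sum)
  finally show ?thesis .
qed

lemma continuous_on_monomial: "continuous_on pos_orthant (monomial \<mu>)"
  unfolding monomial_def
  by (intro continuous_intros) (auto simp: pos_orthant_def less_imp_neq [symmetric])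

lemma continuous_on_signomial:
  assumes "signomial f S c"
  shows "continuous_on pos_orthant f"
proof -
  have "continuous_on pos_orthant (\<lambda>x. \<Sum>\<mu>\<in>S. c \<mu> * monomial \<mu> x)"
    by (intro continuous_intros continuous_on_monomial)
  then show ?thesis
    using assms by (simp add: signomial_def cong: continuous_on_cong)
qed

lemma convex_pos_orthant: "convex (pos_orthant :: (real ^ 'n) set)"
proof -
  have "pos_orthant = (\<Inter>i. {x :: real ^ 'n. 0 < axis i 1 \<bullet> x})"
    by (auto simp: pos_orthant_def inner_axis')
  also have "convex \<dots>"
    by (intro convex_INT convex_halfspace_gt)
  finally show ?thesis .
qed

text \<open>Flowing and normalising multiplies the term of \<open>\<mu>\<close> by
  \<open>exp (s * (v \<bullet> \<mu> - a))\<close>, which is at most 1 on positive terms and at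
  least 1 on negative ones, so no term grows. For \<open>\<beta>\<close>, the tangent bound
  \<open>exp u \<ge> 1 + u\<close> gives a decrease linear in \<open>s\<close>.\<close>

lemma signomial_monomial_flow_le:
  assumes f: "signomial f S c" and sep: "separates_at S c v a"
    and \<beta>: "\<beta> \<in> neg_support S c" and x: "x \<in> pos_orthant" and s: "0 \<le> s"
  shows "exp (- s * a) * f (monomial_flow v s x)
           \<le> f x - s * ((v \<bullet> \<beta> - a) * (- c \<beta> * monomial \<beta> x))"
proof -
  have S: "finite S" "\<beta> \<in> S" and c\<beta>: "c \<beta> < 0"
    using f \<beta> by (auto simp: signomial_def neg_support_def)
  define T where "T \<mu> = c \<mu> * monomial \<mu> x * exp (s * (v \<bullet> \<mu> - a))" for \<mu>
  have "exp (- s * a) * f (monomial_flow v s x)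
      = (\<Sum>\<mu>\<in>S. exp (- s * a) * (c \<mu> * monomial \<mu> (monomial_flow v s x)))"
    using f x by (simp add: signomial_def sum_distrib_left)
  also have "\<dots> = (\<Sum>\<mu>\<in>S. T \<mu>)"
    using x by (intro sum.cong refl)
      (simp add: T_def monomial_monomial_flow right_diff_distrib exp_diff exp_minus divide_simps)
  also have "\<dots> = T \<beta> + (\<Sum>\<mu>\<in>S - {\<beta>}. T \<mu>)"
    using S by (simp add: sum.remove)
  also have "\<dots> \<le> c \<beta> * monomial \<beta> x * (1 + s * (v \<bullet> \<beta> - a))
      + (\<Sum>\<mu>\<in>S - {\<beta>}. c \<mu> * monomial \<mu> x)"
  proof (intro add_mono sum_mono)
    show "T \<beta> \<le> c \<beta> * monomial \<beta> x * (1 + s * (v \<bullet> \<beta> - a))"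
      unfolding T_def using c\<beta> monomial_pos [OF x, of \<beta>]
      by (intro mult_left_mono_neg exp_ge_add_one_self) (simp add: mult_nonpos_nonneg)
  next
    fix \<mu> assume "\<mu> \<in> S - {\<beta>}"
    then consider "\<mu> \<in> pos_support S c" | "\<mu> \<in> neg_support S c"
      using f by (force simp: signomial_def pos_support_def neg_support_def)
    then show "T \<mu> \<le> c \<mu> * monomial \<mu> x"
    proof cases
      case 1
      then have "exp (s * (v \<bullet> \<mu> - a)) \<le> 1" "0 < c \<mu>"
        using sep s by (auto simp: separates_at_def pos_support_def mult_nonneg_nonpos)
      then show ?thesis
        unfolding T_def using monomial_pos [OF x, of \<mu>] by (simp add: mult_left_le)
    next
      case 2
      then have "1 \<le> exp (s * (v \<bullet> \<mu> - a))" "c \<mu> < 0"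
        using sep s by (auto simp: separates_at_def neg_support_def)
      then show ?thesis
        unfolding T_def using monomial_pos [OF x, of \<mu>]
          mult_left_mono_neg [of 1 "exp (s * (v \<bullet> \<mu> - a))" "c \<mu> * monomial \<mu> x"]
        by (simp add: mult_nonpos_nonneg)
    qed
  qed
  also have "\<dots> = (\<Sum>\<mu>\<in>S. c \<mu> * monomial \<mu> x)
      - s * ((v \<bullet> \<beta> - a) * (- c \<beta> * monomial \<beta> x))"
    using S by (simp add: sum.remove algebra_simps)
  also have "(\<Sum>\<mu>\<in>S. c \<mu> * monomial \<mu> x) = f x"
    using f x by (simp add: signomial_def)
  finally show ?thesis .
qed

text \<open>On \<open>N\<close>, the map \<open>g\<close> factors through the contractible
  \<open>U\<close>, so it is null-homotopic within \<open>N\<close>; hence so is the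
  identity.\<close>

lemma contractible_if_homotopic_id_extends:
  fixes N U :: "'a::real_normed_vector set"
  assumes "homotopic_with_canon (\<lambda>_. True) N N id g"
    and "N \<subseteq> U" "continuous_on U g" "g \<in> U \<rightarrow> N" "contractible U"
  shows "contractible N"
proof -
  obtain p where "homotopic_with_canon (\<lambda>_. True) N N (g \<circ> id) (\<lambda>_. p)"
    by (rule nullhomotopic_through_contractible [of N id U g N]) (use assms in auto)
  with assms(1) show ?thesis
    unfolding contractible_def by (auto intro: homotopic_with_trans)
qed

theorem theorem3p6:
  fixes f :: "real ^ 'n \<Rightarrow> real"
    and S :: "(real ^ 'n) set"
    and c :: "real ^ 'n \<Rightarrow> real"
  assumes "signomial f S c"
    and "\<exists>v. strict_separating_vector S c v"
  shows "({x \<in> pos_orthant. f x < 0} \<noteq> {} \<and> contractible {x \<in> pos_orthant. f x < 0}) \<and>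
         top_of_set pos_orthant closure_of {x \<in> pos_orthant. f x < 0} =
           {x \<in> pos_orthant. f x \<le> 0} \<and>
         (\<exists>\<^sub>\<le>\<^sub>1C. negative_component f C)"
proof -
  obtain v a \<beta> where sep: "separates_at S c v a" and \<beta>: "\<beta> \<in> neg_support S c"
    and v\<beta>: "v \<bullet> \<beta> > a"
    using assms(2) by (auto simp: strict_separating_vector_def)
  define N where "N = {x \<in> pos_orthant. f x < 0}"
  \<comment> \<open>This is \<open>\<delta> B\<close>, the guaranteed decrease per unit of
    time.\<close>
  define D where "D x = (v \<bullet> \<beta> - a) * (- c \<beta> * monomial \<beta> x)" for x
  have D_pos: "0 < D x" if "x \<in> pos_orthant" for x
    using \<beta> v\<beta> monomial_pos [OF that, of \<beta>]
    by (simp add: D_def neg_support_def mult_pos_neg mult_neg_pos)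
  \<comment> \<open>One criterion with three uses: a long enough time from any point, every time
    \<open>s \<ge> 0\<close> from a point of \<open>N\<close>, and every positive time from a zero
    of \<open>f\<close>.\<close>
  have flow_N: "monomial_flow v s x \<in> N" if "x \<in> pos_orthant" "0 \<le> s" "f x < s * D x" for x s
  proof -
    have "exp (- s * a) * f (monomial_flow v s x) < 0"
      using signomial_monomial_flow_le [OF assms(1) sep \<beta> that(1,2)] that(3)
      by (simp add: D_def)
    then show ?thesis
      using that by (simp add: N_def mult_less_0_iff)
  qed

  \<comment> \<open>The summand \<open>1\<close> makes \<open>\<tau> x * D x\<close> exceed
    \<open>f x\<close> strictly; the absolute value keeps \<open>\<tau>\<close> nonnegative where
    \<open>f\<close> is negative.\<close>
  define \<tau> where "\<tau> x = (1 + \<bar>f x\<bar>) / D x" for x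
  define \<phi> where "\<phi> x = monomial_flow v (\<tau> x) x" for x
  have cont_f: "continuous_on pos_orthant f"
    using assms(1) by (rule continuous_on_signomial)
  have cont_\<tau>: "continuous_on pos_orthant \<tau>"
    unfolding \<tau>_def D_def
    by (intro continuous_intros continuous_on_monomial cont_f)
      (use D_pos in \<open>force simp: D_def\<close>)
  have \<tau>_nonneg: "0 \<le> \<tau> x" if "x \<in> pos_orthant" for x
    using D_pos [OF that] by (simp add: \<tau>_def)
  have \<phi>_N: "\<phi> x \<in> N" if "x \<in> pos_orthant" for x
    unfolding \<phi>_def using that
  proof (rule flow_N)
    show "f x < \<tau> x * D x"
      using D_pos [OF that] by (simp add: \<tau>_def)
  qed (rule \<tau>_nonneg [OF that])

  \<comment> \<open>Any point of the orthant would do, since \<open>\<phi>\<close> carries it into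
    \<open>N\<close>.\<close>
  have "(\<chi> i. 1) \<in> (pos_orthant :: (real ^ 'n) set)"
    by (simp add: pos_orthant_def)
  then have nonempty: "N \<noteq> {}"
    using \<phi>_N by blast

  have N_sub: "N \<subseteq> pos_orthant"
    by (auto simp: N_def)
  have contr: "contractible N"
  proof (rule contractible_if_homotopic_id_extends)
    \<comment> \<open>Scaling the flow time by \<open>t\<close> leads from the identity to
      \<open>\<phi>\<close>. The path stays in \<open>N\<close> because
      \<open>f x < 0 \<le> t * \<tau> x * D x\<close>.\<close>
    define h where "h = (\<lambda>(t, x). monomial_flow v (t * \<tau> x) x)"
    have "continuous_on ({0..1} \<times> N) h"
      unfolding h_def case_prod_unfold using N_sub
      by (intro continuous_intros continuous_on_compose2 [OF cont_\<tau>]) auto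
    moreover have "h \<in> {0..1} \<times> N \<rightarrow> N"
    proof clarify
      fix t x assume t: "t \<in> {0..1::real}" and x: "x \<in> N"
      then have "x \<in> pos_orthant" "f x < 0"
        by (auto simp: N_def)
      moreover from this t have "0 \<le> t * \<tau> x" "0 \<le> t * \<tau> x * D x"
        using \<tau>_nonneg D_pos [of x] by auto
      ultimately show "h (t, x) \<in> N"
        unfolding h_def by (auto intro: flow_N)
    qed
    ultimately show "homotopic_with_canon (\<lambda>_. True) N N id \<phi>"
      unfolding homotopic_with_def
      by (intro exI [of _ h]) (auto simp: h_def \<phi>_def prod_topology_subtopology_eu)
    show "continuous_on pos_orthant \<phi>"
      unfolding \<phi>_def by (intro continuous_intros cont_\<tau>)
    show "contractible (pos_orthant :: (real ^ 'n) set)"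
      by (rule convex_imp_contractible [OF convex_pos_orthant])
  qed (use N_sub \<phi>_N in auto)

  have closure: "top_of_set pos_orthant closure_of N = {x \<in> pos_orthant. f x \<le> 0}"
  proof (intro equalityI)
    have "closedin (top_of_set pos_orthant) (pos_orthant \<inter> f -` {..0})"
      by (rule continuous_closedin_preimage [OF cont_f closed_atMost])
    then show "top_of_set pos_orthant closure_of N \<subseteq> {x \<in> pos_orthant. f x \<le> 0}"
      by (intro closure_of_minimal) (auto simp: N_def vimage_def Collect_conj_eq)
  next
    show "{x \<in> pos_orthant. f x \<le> 0} \<subseteq> top_of_set pos_orthant closure_of N"
    proof clarify
      fix x assume x: "x \<in> pos_orthant" "f x \<le> 0"
      \<comment> \<open>The points of \<open>N\<close> approximating \<open>x\<close> lie on its own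
        flow line, at times decreasing to 0: for \<open>s > 0\<close> one has
        \<open>f x \<le> 0 < s * D x\<close>.\<close>
      have "continuous_on UNIV (\<lambda>s. monomial_flow v s x)"
        by (intro continuous_intros)
      then have "(\<lambda>s. monomial_flow v s x) \<midarrow>0\<rightarrow> x"
        by (metis UNIV_I continuous_on_def monomial_flow_0)
      then have "((\<lambda>s. monomial_flow v s x) \<longlongrightarrow> x) (at_right 0)"
        by (rule tendsto_within_subset) simp
      moreover have "\<forall>\<^sub>F s in at_right 0. monomial_flow v s x \<in> closure N"
        using eventually_at_right_less [of 0]
      proof eventually_elim
        case (elim s)
        then have "f x < s * D x"
          using x D_pos [OF x(1)] by (simp add: order_le_less_trans)
        then show ?case
          using flow_N x elim closure_subset by fastforce
      qed
      ultimately have "x \<in> closure N"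
        by (intro Lim_in_closed_set [OF closed_closure]) auto
      then show "x \<in> top_of_set pos_orthant closure_of N"
        using x N_sub by (simp add: closure_of_subtopology inf_absorb2)
    qed
  qed

  \<comment> \<open>The connected set \<open>N\<close> meets \<open>C\<close>, so it lies in the
    component \<open>C\<close>. Two negative components then share the nonempty \<open>N\<close> and
    coincide.\<close>
  have "N \<subseteq> C" if "negative_component f C" for C
  proof (rule components_maximal)
    show "C \<in> components (nonvanishing_set f)"
      using that by (simp add: negative_component_def)
    show "connected N"
      using contr by (rule contractible_imp_connected)
    show "N \<subseteq> nonvanishing_set f"
      by (auto simp: N_def nonvanishing_set_def)
    show "C \<inter> N \<noteq> {}"
      using that in_components_nonempty in_components_subset
      by (fastforce simp: negative_component_def nonvanishing_set_def N_def)
  qed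
  then have "\<exists>\<^sub>\<le>\<^sub>1C. negative_component f C"
    using nonempty unfolding Uniq_def
    by (metis components_nonoverlap disjoint_iff ex_in_conv negative_component_def subsetD)
  with nonempty contr closure show ?thesis
    by (simp add: N_def)
qed

end
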